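(* A finitely connected planar domain $D$ is a holomorphic homogeneous regular domain if and only if each connected component of its complement in $\overline{\mathbb{C}}$ is not a single point.
   Context: $\overline{\mathbb{C}}$ is the Riemann sphere; a planar domain $D\subset\mathbb{C}$ is finitely connected if $\overline{\mathbb{C}}\setminus D$ has finitely many connected components. $\Delta$ is the open unit disc and $\Delta_r$ the open disc with center $0$ and radius $r$. The squeezing function of $D$ is $s_D(p)=\sup_f\,\sup\{r:\Delta_r\subset f(D)\}$, where the outer supremum is over all injective holomorphic maps $f:D\to\Delta$ with $f(p)=0$ (and $s_D\equiv 0$ if no such map exists). A holomorphic homogeneous regular domain is a domain, biholomorphic to a bounded domain, whose squeezing function has a positive lower bound. *)

theory Defs
  imports "HOL-Complex_Analysis.Complex_Analysis"
begin

definition planar_domain :: "complex set \<Rightarrow> bool" where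
  "planar_domain D \<longleftrightarrow> open D \<and> connected D \<and> D \<noteq> {}"

(* The point None is the point at infinity; Some embeds the complex plane. *)
definition riemann_sphere :: "complex option topology" where
  "riemann_sphere = Alexandroff_compactification euclidean"

definition complement_components :: "complex set \<Rightarrow> complex option set set" where
  "complement_components D =
     connected_components_of (subtopology riemann_sphere (topspace riemann_sphere - Some ` D))"

definition finitely_connected :: "complex set \<Rightarrow> bool" where
  "finitely_connected D \<longleftrightarrow> finite (complement_components D)"

definition squeezing_maps :: "complex set \<Rightarrow> complex \<Rightarrow> (complex \<Rightarrow> complex) set" where
  "squeezing_maps D p =
     {f. f holomorphic_on D \<and> inj_on f D \<and> f ` D \<subseteq> ball 0 1 \<and> f p = 0}"

(* Sup is the real supremum, meaningful only on nonempty sets that are bounded above. For a planar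
   domain D and p in D, the radii below are bounded by 1 because f ` D lies in the unit disc, and
   they exist because f ` D is open (open mapping) and contains f p = 0. The only degenerate case
   is the absence of maps, which is treated separately. *)
definition squeezing_function :: "complex set \<Rightarrow> complex \<Rightarrow> real" where
  "squeezing_function D p =
     (if squeezing_maps D p = {} then 0
      else (SUP f\<in>squeezing_maps D p. Sup {r. 0 < r \<and> ball 0 r \<subseteq> f ` D}))"

definition biholomorphic :: "complex set \<Rightarrow> complex set \<Rightarrow> bool" where
  "biholomorphic D E \<longleftrightarrow>
     (\<exists>f g. f holomorphic_on D \<and> g holomorphic_on E \<and> f ` D = E \<and> g ` E = D \<and>
            (\<forall>z\<in>D. g (f z) = z) \<and> (\<forall>w\<in>E. f (g w) = w))"

definition holomorphic_homogeneous_regular :: "complex set \<Rightarrow> bool" where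
  "holomorphic_homogeneous_regular D \<longleftrightarrow>
     planar_domain D \<and>
     (\<exists>E. planar_domain E \<and> bounded E \<and> biholomorphic D E) \<and>
     (\<exists>c>0. \<forall>p\<in>D. c \<le> squeezing_function D p)"

end

(* Suppose {x} is a component of the complement. As there are finitely many components, x is isolated,
   so a punctured disc around x lies in D. A competing map f with f p = 0, pulled back to the punctured
   disc, extends over the puncture to a self-map of the disc whose value at the puncture is not in f(D).
   By the Schwarz-Pick lemma that value has modulus at most the modulus of the coordinate of p, hence the
   squeezing function tends to 0 at x.

   Conversely, let no component be a point. For a component K the set sphere - K is simply connected;
   take its Riemann map phi onto the disc. The other components go to a compact subset of the disc, and
   phi(p) tends to the unit circle as p tends to K, so following phi by the disc automorphism that sends
   phi(p) to 0 yields a competing map whose image contains a disc of radius independent of p. Thus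
   the squeezing function is bounded below near each boundary point. Near interior points such a
   bound is elementary, and the sphere is compact. *)

theory Submission
  imports Defs
begin

subsection \<open>The squeezing function\<close>

lemma squeezing_radius_le_1:
  assumes "f \<in> squeezing_maps D p" "0 < r" "ball 0 r \<subseteq> f ` D"
  shows "r \<le> 1"
proof -
  have "ball (0::complex) r \<subseteq> ball 0 1"
    using assms by (auto simp: squeezing_maps_def)
  then show ?thesis
    using assms(2) by (simp add: ball_subset_ball_iff)
qed

lemma squeezing_radii_nonempty:
  assumes "open D" "p \<in> D" "f \<in> squeezing_maps D p"
  shows "\<exists>r>0. ball 0 r \<subseteq> f ` D"
proof -
  have "open (f ` D)"
    using assms by (intro open_mapping_thm3) (auto simp: squeezing_maps_def)
  moreover have "0 \<in> f ` D"
    using assms by (force simp: squeezing_maps_def)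
  ultimately show ?thesis
    using open_contains_ball by blast
qed

text \<open>A real supremum dominates its members only over a set that is bounded above. The bound 1
  on all radii serves for the inner supremum and for the outer one.\<close>

lemma squeezing_function_ge:
  assumes "open D" "p \<in> D" "f \<in> squeezing_maps D p" "0 < c" "ball 0 c \<subseteq> f ` D"
  shows "c \<le> squeezing_function D p"
proof -
  let ?S = "\<lambda>f. Sup {r. 0 < r \<and> ball 0 r \<subseteq> f ` D}"
  have bdd: "bdd_above {r. 0 < r \<and> ball 0 r \<subseteq> g ` D}" if "g \<in> squeezing_maps D p" for g
    using squeezing_radius_le_1[OF that] by (intro bdd_aboveI[of _ 1]) auto
  have "?S g \<le> 1" if "g \<in> squeezing_maps D p" for g
    using squeezing_radius_le_1[OF that] squeezing_radii_nonempty[OF assms(1,2) that]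
    by (intro cSup_least) auto
  then have "bdd_above (?S ` squeezing_maps D p)"
    by (intro bdd_aboveI[of _ 1]) auto
  moreover have "c \<le> ?S f"
    using bdd assms by (intro cSup_upper) auto
  ultimately have "c \<le> (SUP f\<in>squeezing_maps D p. ?S f)"
    using assms(3) by (meson cSUP_upper2)
  then show ?thesis
    using assms(3) by (auto simp: squeezing_function_def)
qed

text \<open>The assumption \<open>0 \<le> b\<close> covers the default value 0, taken when there is
  no competing map.\<close>

lemma squeezing_function_le:
  assumes "open D" "p \<in> D" "0 \<le> b"
    and "\<And>f r. \<lbrakk>f \<in> squeezing_maps D p; 0 < r; ball 0 r \<subseteq> f ` D\<rbrakk> \<Longrightarrow> r \<le> b"
  shows "squeezing_function D p \<le> b"
proof -
  have "Sup {r. 0 < r \<and> ball 0 r \<subseteq> f ` D} \<le> b" if "f \<in> squeezing_maps D p" for f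
    using squeezing_radii_nonempty[OF assms(1,2) that] assms(4)[OF that]
    by (intro cSup_least) auto
  then show ?thesis
    using assms(3) by (auto simp: squeezing_function_def intro!: cSUP_least)
qed

lemma squeezing_function_nonneg:
  assumes "open D" "p \<in> D"
  shows "0 \<le> squeezing_function D p"
proof (cases "squeezing_maps D p = {}")
  case False
  then obtain f r where "f \<in> squeezing_maps D p" "0 < r" "ball 0 r \<subseteq> f ` D"
    using squeezing_radii_nonempty[OF assms] by blast
  then show ?thesis
    using squeezing_function_ge[OF assms] by force
qed (simp add: squeezing_function_def)

lemma squeezing_function_image_le:
  assumes "open D" "p \<in> D" "h holomorphic_on D" "inj_on h D"
  shows "squeezing_function (h ` D) (h p) \<le> squeezing_function D p"
proof (rule squeezing_function_le)
  show "open (h ` D)"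
    using assms by (intro open_mapping_thm3)
  fix f and r :: real
  assume f: "f \<in> squeezing_maps (h ` D) (h p)" and r: "0 < r" "ball 0 r \<subseteq> f ` h ` D"
  have "f \<circ> h \<in> squeezing_maps D p"
    using f assms
    by (auto simp: squeezing_maps_def image_comp intro!: comp_inj_on holomorphic_on_compose)
  then show "r \<le> squeezing_function D p"
    using r assms by (intro squeezing_function_ge[of _ _ "f \<circ> h"]) (simp_all only: image_comp)
qed (use assms squeezing_function_nonneg in auto)

lemma biholomorphic_image:
  assumes "open D" "h holomorphic_on D" "inj_on h D"
  shows "biholomorphic D (h ` D)"
proof -
  obtain g where g: "g holomorphic_on h ` D" "\<And>z. z \<in> D \<Longrightarrow> g (h z) = z"
    using holomorphic_has_inverse[OF assms(2,1,3)] by metis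
  then show ?thesis
    unfolding biholomorphic_def using assms by (intro exI[of _ h] exI[of _ g]) (auto simp: image_image)
qed

section \<open>Upper bound near an isolated point of the complement\<close>

text \<open>The disc automorphism \<open>Moebius_function 0 (-w)\<close> takes 0 to \<open>w\<close>
  and \<open>-w\<close> to 0. Hence \<open>?h\<close> fixes 0, and the Schwarz lemma at
  \<open>-w\<close> bounds \<open>f 0\<close>.\<close>

lemma Schwarz_Pick_at_zero:
  assumes holf: "f holomorphic_on ball 0 1" and f: "f ` ball 0 1 \<subseteq> ball 0 1"
    and w: "norm w < 1" "f w = 0"
  shows "norm (f 0) \<le> norm w"
proof -
  let ?h = "f \<circ> Moebius_function 0 (-w)"
  have "norm (?h (-w)) \<le> norm (-w)"
  proof (rule Schwarz_Lemma(1)[of ?h "- w"])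
    have "Moebius_function 0 (-w) ` ball 0 1 \<subseteq> ball 0 1"
      using w Moebius_function_norm_lt_1[of "-w"] by auto
    then show "?h holomorphic_on ball 0 1"
      using w by (intro holomorphic_on_compose_gen[OF _ holf] Moebius_function_holomorphic) auto
    show "?h 0 = 0"
      using w by (simp add: Moebius_function_of_zero)
    show "norm (?h z) < 1" if "norm z < 1" for z
      using that w f Moebius_function_norm_lt_1[of "-w" z 0] by (simp add: image_subset_iff)
  qed (use w in auto)
  then show ?thesis
    by (simp add: Moebius_function_eq_zero)
qed

text \<open>The chart \<open>\<phi>\<close> of a punctured neighbourhood lets a finite puncture and
  infinity be treated alike. The assumption \<open>escape\<close> says that \<open>\<phi> w\<close>
  accumulates at no point of \<open>D\<close> as \<open>w\<close> tends to 0, so \<open>D\<close>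
  does not fill the puncture.\<close>

lemma squeezing_function_le_isolated:
  assumes D: "open D"
    and hol: "\<phi> holomorphic_on ball 0 1 - {0}" and inj: "inj_on \<phi> (ball 0 1 - {0})"
    and sub: "\<phi> ` (ball 0 1 - {0}) \<subseteq> D"
    and escape: "\<And>q. q \<in> D \<Longrightarrow> \<exists>N \<delta>. open N \<and> q \<in> N \<and> 0 < \<delta> \<and> (\<forall>w. 0 < norm w \<and> norm w < \<delta> \<longrightarrow> \<phi> w \<notin> N)"
    and w: "0 < norm w" "norm w < 1"
  shows "squeezing_function D (\<phi> w) \<le> norm w"
proof (rule squeezing_function_le[OF D])
  show "\<phi> w \<in> D"
    using sub w by auto
  fix f and r :: real
  assume f: "f \<in> squeezing_maps D (\<phi> w)" and r: "0 < r" "ball 0 r \<subseteq> f ` D"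
  have holf: "f holomorphic_on D" and injf: "inj_on f D" and fD: "f ` D \<subseteq> ball 0 1"
    and f0: "f (\<phi> w) = 0"
    using f by (auto simp: squeezing_maps_def)
  have hol': "(f \<circ> \<phi>) holomorphic_on ball 0 1 - {0}"
    using hol holf sub by (rule holomorphic_on_compose_gen)
  have inj': "inj_on (f \<circ> \<phi>) (ball 0 1 - {0})"
    using inj injf sub by (meson comp_inj_on inj_on_subset)
  have lt1: "norm (f (\<phi> z)) < 1" if "z \<in> ball 0 1 - {0}" for z
    using that fD sub by (auto simp: image_subset_iff)
  have ev: "eventually (\<lambda>z. norm ((f \<circ> \<phi>) z) \<le> 1) (at 0)"
    unfolding eventually_at using lt1
    by (intro exI[of _ 1]) (auto simp: dist_norm intro: less_imp_le)
  \<comment> \<open>Riemann's removable singularity theorem applies, since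
    \<open>f \<circ> \<phi>\<close> is bounded by 1.\<close>
  have "\<exists>g. g holomorphic_on ball 0 1 \<and> (\<forall>z\<in>ball 0 1 - {0}. g z = (f \<circ> \<phi>) z)"
    using holomorphic_on_extend_bounded[OF hol'] ev by auto
  then obtain g where holg: "g holomorphic_on ball 0 1"
    and g: "\<And>z. z \<in> ball 0 1 - {0} \<Longrightarrow> g z = f (\<phi> z)"
    by auto
  have nconst: "\<not> g constant_on ball 0 1"
  proof
    assume "g constant_on ball 0 1"
    then have "g (1/2) = g (1/3)"
      by (auto simp: constant_on_def norm_divide)
    then have "(f \<circ> \<phi>) (1/2) = (f \<circ> \<phi>) (1/3)"
      using g[of "1/2"] g[of "1/3"] by (simp add: norm_divide)
    from inj_onD[OF inj' this] show False
      by (simp add: norm_divide)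
  qed
  have og: "open (g ` U)" if "open U" "U \<subseteq> ball 0 1" for U
    using open_mapping_thm[OF holg open_ball _ that nconst] by simp
  \<comment> \<open>By continuity the value at the puncture has modulus at most 1. The image is
    open, so it lies in the interior of the closed disc.\<close>
  have gball: "g ` ball 0 1 \<subseteq> ball 0 1"
  proof -
    have le: "norm (g z) \<le> 1" if "z \<in> ball 0 1" for z
    proof (cases "z = 0")
      case True
      have "isCont g 0"
        using holomorphic_on_imp_continuous_on[OF holg] by (simp add: continuous_on_eq_continuous_at)
      then have "(g \<longlongrightarrow> g 0) (at 0)"
        by (simp add: isCont_def)
      moreover have "eventually (\<lambda>z. norm (g z) \<le> 1) (at 0)"
        unfolding eventually_at using lt1 g
        by (intro exI[of _ 1]) (auto simp: dist_norm intro: less_imp_le)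
      ultimately show ?thesis
        using True by (metis Lim_norm_ubound trivial_limit_at)
    qed (use that g lt1[of z] in auto)
    then have "g ` ball 0 1 \<subseteq> interior (cball 0 1)"
      using og[OF open_ball order_refl] by (intro interior_maximal) auto
    then show ?thesis
      by simp
  qed
  \<comment> \<open>If \<open>g 0 = f q\<close>, then \<open>W\<close> is an open neighbourhood of
    this value and contains a second value \<open>y\<close>. It is attained by \<open>g\<close> at
    some small \<open>z \<noteq> 0\<close> and by \<open>f\<close> at some \<open>q'\<close> in
    \<open>N\<close>; injectivity of \<open>f\<close> gives \<open>\<phi> z = q'\<close>, against
    \<open>escape\<close>.\<close>
  have "g 0 \<notin> f ` D"
  proof
    assume "g 0 \<in> f ` D"
    then obtain q where q: "q \<in> D" "g 0 = f q"
      by auto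
    from escape[OF q(1)] obtain N \<delta> where N: "open N" "q \<in> N" "0 < \<delta>"
      and esc: "\<And>w. 0 < norm w \<Longrightarrow> norm w < \<delta> \<Longrightarrow> \<phi> w \<notin> N"
      by blast
    define W where "W = f ` (N \<inter> D) \<inter> g ` ball 0 (min \<delta> 1)"
    have "open W"
      unfolding W_def using N D holf injf
      by (intro open_Int open_mapping_thm3 og) (auto intro: holomorphic_on_subset inj_on_subset)
    moreover have "f q \<in> W"
      unfolding W_def using q N by (auto intro!: rev_image_eqI[of "0::complex"])
    ultimately have "W \<noteq> {f q}"
      using not_open_singleton by metis
    with \<open>f q \<in> W\<close> obtain y where y: "y \<in> W" "y \<noteq> f q"
      by blast
    then obtain z q' where z: "y = g z" "norm z < \<delta>" "norm z < 1" and q': "y = f q'" "q' \<in> N" "q' \<in> D"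
      by (auto simp: W_def)
    have "z \<noteq> 0"
      using y z q by auto
    then have "f (\<phi> z) = f q'"
      using z q' g[of z] by auto
    then have "\<phi> z = q'"
      using injf q' sub z \<open>z \<noteq> 0\<close> by (auto simp: inj_on_eq_iff image_subset_iff)
    then show False
      using esc[of z] z q' \<open>z \<noteq> 0\<close> by auto
  qed
  then have "r \<le> norm (g 0)"
    using r by (metis mem_ball_0 not_le subsetD)
  also have "norm (g 0) \<le> norm w"
    using holg gball w g f0 by (intro Schwarz_Pick_at_zero) auto
  finally show "r \<le> norm w" .
qed (use w in auto)

subsection \<open>Riemann maps of filled domains\<close>

text \<open>The denominator \<open>1 - cnj a * w\<close> has modulus at most 2. The estimate keeps
  the image of a compact part of the disc away from 0, uniformly for \<open>a\<close> near the unit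
  circle.\<close>

lemma Moebius_function_norm_ge:
  assumes "norm a < 1" "norm w < 1"
  shows "(norm a - norm w) / 2 \<le> norm (Moebius_function 0 a w)"
proof -
  have "norm (cnj a * w) < 1"
    using norm_mult_less[of "cnj a" 1 w 1] assms by simp
  then have nz: "1 - cnj a * w \<noteq> 0"
    by auto
  have le2: "norm (1 - cnj a * w) \<le> 2"
    using norm_triangle_ineq4[of 1 "cnj a * w"] \<open>norm (cnj a * w) < 1\<close> by simp
  have "(norm a - norm w) / 2 \<le> norm (w - a) / 2"
    using norm_triangle_ineq2[of a w] by (simp add: norm_minus_commute)
  also have "\<dots> \<le> norm (w - a) / norm (1 - cnj a * w)"
    using nz le2 by (intro divide_left_mono) auto
  finally show ?thesis
    by (simp add: Moebius_function_simple norm_divide)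
qed

text \<open>The set \<open>- F\<close> is \<open>D\<close> with the holes \<open>B\<close> filled
  in. Assumption \<open>unbdd\<close> is the planar form of connectedness of \<open>F\<close> with
  infinity adjoined. The proof uses the criterion that an open connected planar set is simply
  connected when all components of its complement are unbounded.\<close>

lemma simply_connected_fill:
  assumes D: "open D" "connected D" "D \<noteq> {}"
    and eq: "- D = F \<union> B" "F \<inter> B = {}" and F: "closed F" and B: "compact B"
    and unbdd: "\<And>T. \<lbrakk>T \<subseteq> F; compact T; closed (F - T)\<rbrakk> \<Longrightarrow> T = {}"
  shows "simply_connected (- F :: complex set)"
proof -
  have sub: "D \<subseteq> - F" and F_eq: "- F = D \<union> B"
    using eq by auto
  have "connected (- F)"
  proof (rule connectedI)
    fix P Q
    assume P: "open P" "P \<inter> - F \<noteq> {}" and Q: "open Q" "Q \<inter> - F \<noteq> {}"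
      and PQ: "P \<inter> Q \<inter> - F = {}" "- F \<subseteq> P \<union> Q"
    \<comment> \<open>In a separation of \<open>- F\<close>, the side missing \<open>D\<close> lies
      in \<open>B\<close> and equals \<open>B - V\<close>. It is thus both compact and open in the
      plane, hence empty.\<close>
    have no: "U = {}" if U: "open U" "U \<inter> D = {}" "U \<subseteq> - F" "open V" "U \<inter> V = {}" "- F \<subseteq> U \<union> V" for U V
    proof -
      have "U = B - V"
        using U F_eq by auto
      then have "compact U"
        using B U by (simp add: compact_diff)
      then show ?thesis
        using U(1) by (metis compact_eq_bounded_closed clopen not_bounded_UNIV)
    qed
    have "P \<inter> D = {} \<or> Q \<inter> D = {}"
      using P Q PQ sub by (intro connectedD[OF D(2)]) auto
    then show False
    proof
      assume "P \<inter> D = {}"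
      have "P \<inter> - F = {}"
        by (rule no[of _ "Q \<inter> - F"]) (use P Q PQ F \<open>P \<inter> D = {}\<close> in \<open>auto simp: open_Compl\<close>)
      then show False
        using P by simp
    next
      assume "Q \<inter> D = {}"
      have "Q \<inter> - F = {}"
        by (rule no[of _ "P \<inter> - F"]) (use P Q PQ F \<open>Q \<inter> D = {}\<close> in \<open>auto simp: open_Compl\<close>)
      then show False
        using Q by simp
    qed
  qed
  moreover have "\<not> bounded C" if C: "C \<in> components F" for C
  proof
    assume "bounded C"
    then have cC: "compact C"
      using C F closed_components compact_eq_bounded_closed by blast
    have lF: "locally compact F"
      using F by (rule closed_imp_locally_compact)
    \<comment> \<open>Sura-Bura: a compact component of \<open>F\<close> lies in a compact,
      relatively open part \<open>T\<close> of \<open>F\<close>. Such a part is excluded by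
      \<open>unbdd\<close>.\<close>
    obtain T where T: "openin (top_of_set F) T" "compact T" "C \<subseteq> T"
      by (rule Sura_Bura_clopen_subset[OF lF C cC open_UNIV]) auto
    obtain V where V: "open V" "T = F \<inter> V"
      using T(1) openin_open by blast
    have "closed (F - V)"
      using F V by (simp add: closed_Diff)
    moreover have "F - V = F - T"
      using V by auto
    ultimately have "T = {}"
      using unbdd[of T] T(2) V(2) by auto
    then show False
      using T(3) in_components_nonempty[OF C] by auto
  qed
  ultimately show ?thesis
    using simply_connected_eq_unbounded_complement_components[of "- F"] F by auto
qed

text \<open>The Riemann map of \<open>- F\<close> serves twice: restricted to \<open>D\<close> it
  gives a bounded model, and recentred at \<open>\<phi> p\<close> it gives the competing maps for
  points \<open>p\<close> far out.\<close>

lemma uniformize_unbounded_complement: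
  assumes D: "open D" "connected D" "D \<noteq> {}"
    and eq: "- D = F \<union> B" "F \<inter> B = {}" and F: "closed F" "F \<noteq> {}" and B: "compact B"
    and unbdd: "\<And>T. \<lbrakk>T \<subseteq> F; compact T; closed (F - T)\<rbrakk> \<Longrightarrow> T = {}"
  obtains \<phi> :: "complex \<Rightarrow> complex" and R c where
    "\<phi> holomorphic_on D" "inj_on \<phi> D" "\<phi> ` D \<subseteq> ball 0 1" "0 < c"
    "\<And>p. \<lbrakk>p \<in> D; R < norm p\<rbrakk> \<Longrightarrow> c \<le> squeezing_function D p"
proof -
  have DF: "- F = D \<union> B" and sub: "D \<subseteq> - F"
    using eq by auto
  have "simply_connected (- F)"
    by (rule simply_connected_fill[OF D eq F(1) B]) (rule unbdd)
  moreover have "- F \<noteq> {}" "- F \<noteq> UNIV"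
    using D sub F by auto
  moreover have "open (- F)"
    using F by auto
  ultimately have "\<exists>f g. f holomorphic_on - F \<and> g holomorphic_on ball 0 1 \<and>
      (\<forall>z\<in>- F. f z \<in> ball 0 1 \<and> g (f z) = z) \<and> (\<forall>z\<in>ball 0 1. g z \<in> - F \<and> f (g z) = z)"
    using simply_connected_eq_biholomorphic_to_disc[of "- F"] by blast
  then obtain \<phi> \<psi> where hol: "\<phi> holomorphic_on - F" "\<psi> holomorphic_on ball 0 1"
    and \<phi>: "\<And>z. z \<in> - F \<Longrightarrow> \<phi> z \<in> ball 0 1 \<and> \<psi> (\<phi> z) = z"
    and \<psi>: "\<And>z. z \<in> ball 0 1 \<Longrightarrow> \<psi> z \<in> - F \<and> \<phi> (\<psi> z) = z"
    by blast
  have inj: "inj_on \<phi> (- F)"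
    using \<phi> by (metis inj_on_inverseI)
  have "compact (\<phi> ` B)"
    using B DF by (intro compact_continuous_image continuous_on_subset[OF holomorphic_on_imp_continuous_on[OF hol(1)]]) auto
  moreover have "\<phi> ` B \<subseteq> ball 0 1"
    using \<phi> DF by auto
  ultimately obtain \<rho> where \<rho>: "\<rho> < 1" "\<phi> ` B \<subseteq> cball 0 \<rho>"
  proof (cases "B = {}")
    case False
    assume *: "compact (\<phi> ` B)" "\<phi> ` B \<subseteq> ball 0 1" "\<And>\<rho>. \<rho> < 1 \<Longrightarrow> \<phi> ` B \<subseteq> cball 0 \<rho> \<Longrightarrow> thesis"
    have "compact (norm ` \<phi> ` B)"
      using *(1) by (rule compact_continuous_image[rotated]) (intro continuous_intros)
    then obtain s where "s \<in> norm ` \<phi> ` B" "\<forall>t\<in>norm ` \<phi> ` B. t \<le> s"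
      using compact_attains_sup[of "norm ` \<phi> ` B"] False by blast
    then show thesis
      using * by (intro *(3)[of s]) auto
  qed (use that in \<open>auto intro: that[of 0]\<close>)
  \<comment> \<open>A radius strictly between \<open>\<rho>\<close> and 1; the \<open>max\<close>
    makes it positive even if \<open>\<rho>\<close> is negative.\<close>
  define \<rho>' where "\<rho>' = (max 0 \<rho> + 1) / 2"
  have \<rho>': "\<rho> < \<rho>'" "\<rho>' < 1" "0 < \<rho>'"
    using \<rho> by (auto simp: \<rho>'_def)
  \<comment> \<open>Points of \<open>- F\<close> with \<open>\<phi>\<close>-image in
    \<open>cball 0 \<rho>'\<close> form this compact set, so \<open>R < norm p\<close> forces
    \<open>norm (\<phi> p) > \<rho>'\<close>.\<close>
  have "compact (\<psi> ` cball 0 \<rho>')"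
    using \<rho>' by (intro compact_continuous_image continuous_on_subset[OF holomorphic_on_imp_continuous_on[OF hol(2)]]) auto
  then obtain R where R: "\<And>z. z \<in> \<psi> ` cball 0 \<rho>' \<Longrightarrow> norm z \<le> R"
    using compact_imp_bounded bounded_iff by metis
  \<comment> \<open>The second entry is the bound of \<open>Moebius_function_norm_ge\<close> for
    \<open>norm a > \<rho>'\<close> and \<open>norm w \<le> \<rho>\<close>; the entry 1 keeps
    \<open>ball 0 c\<close> inside the unit disc.\<close>
  define c where "c = min 1 ((\<rho>' - \<rho>) / 2)"
  have "0 < c"
    using \<rho>' by (simp add: c_def)
  have bound: "c \<le> squeezing_function D p" if p: "p \<in> D" "R < norm p" for p
  proof -
    define a where "a = \<phi> p"
    have pF: "p \<in> - F"
      using p sub by auto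
    have "a \<notin> cball 0 \<rho>'"
      using R[of p] \<phi>[OF pF] p by (metis a_def imageI not_le)
    then have a: "norm a < 1" "\<rho>' < norm a"
      using \<phi>[OF pF] by (auto simp: a_def)
    let ?f = "Moebius_function 0 a \<circ> \<phi>"
    have mm: "Moebius_function 0 (- a) (Moebius_function 0 a z) = z"
      "Moebius_function 0 a (Moebius_function 0 (- a) z) = z" if "norm z < 1" for z
      using Moebius_function_compose[of "- a" a z] Moebius_function_compose[of a "- a" z] a(1) that
      by simp_all
    have f: "?f \<in> squeezing_maps D p"
      unfolding squeezing_maps_def
    proof (intro CollectI conjI)
      show "?f holomorphic_on D"
        using \<phi> sub a by (intro holomorphic_on_compose_gen[OF _ Moebius_function_holomorphic]
            holomorphic_on_subset[OF hol(1)]) auto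
      show "inj_on ?f D"
        using \<phi> sub mm(1) by (intro inj_on_inverseI[of _ "\<psi> \<circ> Moebius_function 0 (- a)"]) auto
      show "?f ` D \<subseteq> ball 0 1"
        using \<phi> sub a by (auto simp: subset_iff intro!: Moebius_function_norm_lt_1)
      show "?f p = 0"
        by (simp add: a_def Moebius_function_eq_zero)
    qed
    \<comment> \<open>Each \<open>y\<close> in the unit disc has a preimage \<open>\<psi> x\<close>
      in \<open>- F\<close>. It could miss \<open>D\<close> only by lying in a hole, but then
      \<open>y\<close> would have modulus at least \<open>(\<rho>' - \<rho>) / 2\<close>.\<close>
    have "ball 0 c \<subseteq> ?f ` D"
    proof
      fix y :: complex
      assume y: "y \<in> ball 0 c"
      then have y1: "norm y < 1" "norm y < (\<rho>' - \<rho>) / 2"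
        by (auto simp: c_def)
      define x where "x = Moebius_function 0 (- a) y"
      have x: "norm x < 1" "Moebius_function 0 a x = y"
        using y1 a Moebius_function_norm_lt_1[of "- a" y 0] mm(2) by (auto simp: x_def)
      have "\<psi> x \<notin> B"
      proof
        assume "\<psi> x \<in> B"
        then have "norm x \<le> \<rho>"
          using \<rho>(2) \<psi>[of x] x by (metis image_subset_iff mem_ball_0 mem_cball_0)
        then have "(\<rho>' - \<rho>) / 2 \<le> norm y"
          using Moebius_function_norm_ge[of a x] x a by (auto simp: field_simps)
        then show False
          using y1 by simp
      qed
      then have "\<psi> x \<in> D"
        using \<psi>[of x] x DF by auto
      then show "y \<in> ?f ` D"
        using \<psi>[of x] x by (intro rev_image_eqI[of "\<psi> x"]) auto
    qed
    then show ?thesis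
      by (rule squeezing_function_ge[OF D(1) p(1) f \<open>0 < c\<close>])
  qed
  show thesis
  proof (rule that)
    show "\<phi> holomorphic_on D" "inj_on \<phi> D"
      using holomorphic_on_subset[OF hol(1) sub] inj_on_subset[OF inj sub] .
    show "\<phi> ` D \<subseteq> ball 0 1"
      using \<phi> sub by blast
  qed (use bound \<open>0 < c\<close> in auto)
qed

subsection \<open>The Riemann sphere\<close>

lemma topspace_riemann_sphere [simp]: "topspace riemann_sphere = UNIV"
  by (simp add: riemann_sphere_def UNIV_option_conv)

lemma compact_space_riemann_sphere: "compact_space riemann_sphere"
  by (simp add: riemann_sphere_def)

lemma Hausdorff_space_riemann_sphere: "Hausdorff_space riemann_sphere"
  by (simp add: riemann_sphere_def Hausdorff_space_Alexandroff_compactification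
      locally_compact_space_euclidean)

lemma openin_riemann_sphere_Some [simp]: "openin riemann_sphere (Some ` U) \<longleftrightarrow> open U"
  by (simp add: riemann_sphere_def)

lemma closedin_riemann_sphere_Some [simp]: "closedin riemann_sphere (Some ` B) \<longleftrightarrow> compact B"
  by (auto simp: riemann_sphere_def compact_imp_closed)

lemma openin_riemann_sphere_None:
  assumes "compact C"
  shows "openin riemann_sphere (insert None (Some ` (- C)))"
  unfolding riemann_sphere_def openin_Alexandroff_compactification
  using assms by (intro disjI2 exI[of _ C]) (simp add: compact_imp_closed flip: Compl_eq_Diff_UNIV)

lemma Compl_image_Some: "- (Some ` V) = insert None (Some ` (- V))"
proof (rule set_eqI)
  show "x \<in> - (Some ` V) \<longleftrightarrow> x \<in> insert None (Some ` (- V))" for x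
    by (cases x) auto
qed

lemma closedin_riemann_sphere_None:
  assumes "closed F"
  shows "closedin riemann_sphere (insert None (Some ` F))"
proof -
  have "UNIV - insert None (Some ` F) = Some ` (- F)"
    using Compl_image_Some[of "- F"] by auto
  then show ?thesis
    using assms by (simp add: closedin_def open_Compl)
qed

lemma openin_riemann_sphere_cases:
  assumes "openin riemann_sphere U"
  obtains V where "open V" "U = Some ` V"
  | C where "compact C" "U = insert None (Some ` (- C))"
proof -
  have "(\<exists>V. open V \<and> U = Some ` V) \<or> (\<exists>C. compact C \<and> U = insert None (Some ` (- C)))"
    using assms unfolding riemann_sphere_def openin_Alexandroff_compactification
    by (auto simp flip: Compl_eq_Diff_UNIV)
  then show thesis
    using that by blast
qed

lemma closedin_riemann_sphere_cases:
  assumes "closedin riemann_sphere K"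
  obtains B where "compact B" "K = Some ` B"
  | F where "closed F" "K = insert None (Some ` F)"
proof -
  have "openin riemann_sphere (- K)"
    using assms by (simp add: closedin_def Compl_eq_Diff_UNIV)
  then show thesis
  proof (cases rule: openin_riemann_sphere_cases)
    case (1 V)
    have "K = - (- K)"
      by simp
    also have "\<dots> = insert None (Some ` (- V))"
      unfolding 1(2) by (rule Compl_image_Some)
    finally show thesis
      using that(2)[of "- V"] 1(1) by (simp add: closed_Compl)
  next
    case (2 C)
    have "K = - (- K)"
      by simp
    also have "\<dots> = Some ` C"
      unfolding 2(2) using Compl_image_Some[of C] by auto
    finally show thesis
      using that(1) 2(1) by simp
  qed
qed

section \<open>Inversion of the sphere, moving a finite point to infinity\<close>

text \<open>The Moebius transformation 1/(z - a) of the sphere. The pole is a separate case because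
  \<open>inverse 0 = 0\<close>.\<close>

definition sphere_inversion :: "complex \<Rightarrow> complex option \<Rightarrow> complex option" where
  "sphere_inversion a x =
     (case x of None \<Rightarrow> Some 0 | Some z \<Rightarrow> if z = a then None else Some (inverse (z - a)))"

lemma sphere_inversion_simps [simp]:
  "sphere_inversion a None = Some 0"
  "sphere_inversion a (Some a) = None"
  "z \<noteq> a \<Longrightarrow> sphere_inversion a (Some z) = Some (inverse (z - a))"
  by (auto simp: sphere_inversion_def)

lemma inj_sphere_inversion: "inj (sphere_inversion a)"
  by (rule injI) (auto simp: sphere_inversion_def split: option.splits if_splits)

lemma surj_sphere_inversion: "surj (sphere_inversion a)"
proof (rule surjI)
  show "sphere_inversion a (case y of None \<Rightarrow> Some a | Some w \<Rightarrow> if w = 0 then None else Some (a + inverse w)) = y" for y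
    by (cases y) (auto simp: sphere_inversion_def)
qed

lemma sphere_inversion_vimage_Some:
  "sphere_inversion a -` (Some ` V) =
     (if 0 \<in> V then {None} else {}) \<union> Some ` {z. z \<noteq> a \<and> inverse (z - a) \<in> V}"
proof (rule set_eqI)
  fix x
  show "x \<in> sphere_inversion a -` (Some ` V) \<longleftrightarrow>
      x \<in> (if 0 \<in> V then {None} else {}) \<union> Some ` {z. z \<noteq> a \<and> inverse (z - a) \<in> V}"
  proof (cases x)
    case (Some z)
    then show ?thesis
      by (cases "z = a") (auto simp: inj_image_mem_iff)
  qed auto
qed

lemma open_inverse_shift_vimage:
  fixes a :: complex
  assumes "open V"
  shows "open {z. z \<noteq> a \<and> inverse (z - a) \<in> V}"
proof -
  have "continuous_on (- {a}) (\<lambda>z. inverse (z - a))"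
    by (intro continuous_intros) auto
  then have "open (- {a} \<inter> (\<lambda>z. inverse (z - a)) -` V)"
    using assms by (intro continuous_open_preimage) auto
  moreover have "- {a} \<inter> (\<lambda>z. inverse (z - a)) -` V = {z. z \<noteq> a \<and> inverse (z - a) \<in> V}"
    by auto
  ultimately show ?thesis
    by simp
qed

lemma continuous_map_sphere_inversion:
  "continuous_map riemann_sphere riemann_sphere (sphere_inversion a)"
proof -
  have "openin riemann_sphere (sphere_inversion a -` U)" if "openin riemann_sphere U" for U
    using that
  proof (cases rule: openin_riemann_sphere_cases)
    case (1 V)
    let ?W = "{z. z \<noteq> a \<and> inverse (z - a) \<in> V}"
    have W: "open ?W"
      using 1(1) by (rule open_inverse_shift_vimage)
    show ?thesis
    proof (cases "0 \<in> V")
      case False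
      then show ?thesis
        using W by (simp add: 1(2) sphere_inversion_vimage_Some)
    next
      case True
      then obtain e where e: "e > 0" "ball 0 e \<subseteq> V"
        using 1(1) open_contains_ball by blast
      \<comment> \<open>Here infinity lies in the preimage, so the complement of \<open>?W\<close>
        must be compact: points far from \<open>a\<close> are inverted into
        \<open>ball 0 e\<close>.\<close>
      have "- ?W \<subseteq> cball a (inverse e)"
      proof
        fix z assume z: "z \<in> - ?W"
        show "z \<in> cball a (inverse e)"
        proof (rule ccontr)
          assume "z \<notin> cball a (inverse e)"
          then have *: "inverse e < norm (z - a)"
            by (simp add: dist_norm norm_minus_commute)
          moreover have "0 < inverse e"
            using e by simp
          ultimately have "z \<noteq> a" "inverse (norm (z - a)) < e"
            using less_imp_inverse_less[OF *] by auto
          then have "inverse (z - a) \<in> ball 0 e"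
            by (simp add: norm_inverse)
          then show False
            using z e(2) \<open>z \<noteq> a\<close> by blast
        qed
      qed
      then have "bounded (- ?W)"
        using bounded_cball bounded_subset by blast
      then have "compact (- ?W)"
        using closed_Compl[OF W] compact_eq_bounded_closed by blast
      from openin_riemann_sphere_None[OF this] show ?thesis
        using True by (simp add: 1(2) sphere_inversion_vimage_Some)
    qed
  next
    case (2 C)
    let ?G = "{z. z \<noteq> a \<and> inverse (z - a) \<in> C}"
    have U: "sphere_inversion a -` U = - (sphere_inversion a -` (Some ` C))"
      by (simp add: 2(2) vimage_Compl flip: Compl_image_Some)
    show ?thesis
    proof (cases "0 \<in> C")
      case False
      \<comment> \<open>Away from 0 the inverse map is continuous, so \<open>?G\<close> is a
        continuous image of a compact set.\<close>
      have "?G = (\<lambda>w. a + inverse w) ` C"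
      proof (intro set_eqI iffI)
        fix z assume "z \<in> ?G"
        then show "z \<in> (\<lambda>w. a + inverse w) ` C"
          by (intro rev_image_eqI[of "inverse (z - a)"]) auto
      next
        fix z assume "z \<in> (\<lambda>w. a + inverse w) ` C"
        then obtain w where "w \<in> C" "z = a + inverse w"
          by blast
        then show "z \<in> ?G"
          using False by auto
      qed
      moreover have "compact ((\<lambda>w. a + inverse w) ` C)"
        using False by (intro compact_continuous_image continuous_intros 2(1)) auto
      ultimately have "compact ?G"
        by (simp only:)
      moreover have "sphere_inversion a -` U = insert None (Some ` (- ?G))"
        using False unfolding U sphere_inversion_vimage_Some Compl_image_Some[symmetric] by simp
      ultimately show ?thesis
        using openin_riemann_sphere_None[of ?G] by (simp only:)
    next
      case True
      obtain r where r: "r > 0" "\<And>w. w \<in> C \<Longrightarrow> norm w \<le> r"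
        using compact_imp_bounded[OF 2(1)] bounded_pos by metis
      let ?W = "{z. z \<noteq> a \<and> inverse (z - a) \<in> - C}"
      \<comment> \<open>Here infinity is outside the preimage, which must be open in the plane. Near
        \<open>a\<close> this holds because the inverted points are too large for the bounded set
        \<open>C\<close>.\<close>
      have far: "z \<in> - ?G" if z: "z \<in> ball a (inverse r)" for z
      proof (cases "z = a")
        case False
        moreover have "norm (z - a) < inverse r"
          using z by (simp add: dist_norm norm_minus_commute)
        ultimately have "r < inverse (norm (z - a))"
          using r(1) by (simp add: field_simps)
        then have "\<not> norm (inverse (z - a)) \<le> r"
          by (simp add: norm_inverse)
        then show ?thesis
          using r(2) by blast
      qed auto
      have "- ?G = ball a (inverse r) \<union> ?W"
      proof (intro set_eqI iffI)
        fix z assume "z \<in> - ?G"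
        then show "z \<in> ball a (inverse r) \<union> ?W"
          using r(1) by (cases "z = a") auto
      qed (use far in auto)
      moreover have "open ?W"
        by (rule open_inverse_shift_vimage) (use 2(1) compact_imp_closed in blast)
      ultimately have "open (- ?G)"
        by (simp only: open_Un open_ball)
      moreover have "sphere_inversion a -` U = Some ` (- ?G)"
        using True Compl_image_Some[of ?G] unfolding U sphere_inversion_vimage_Some by auto
      ultimately show ?thesis
        by (simp only: openin_riemann_sphere_Some)
    qed
  qed
  then show ?thesis
    by (simp add: continuous_map_def vimage_def)
qed

lemma closedin_sphere_inversion_image:
  "closedin riemann_sphere K \<Longrightarrow> closedin riemann_sphere (sphere_inversion a ` K)"
  using continuous_imp_closed_map[OF continuous_map_sphere_inversion
      compact_space_riemann_sphere Hausdorff_space_riemann_sphere]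
  by (simp add: closed_map_def)

subsection \<open>Local lower bounds\<close>

text \<open>A nonempty \<open>T\<close> and the rest of \<open>F\<close> with infinity would be two
  closed sets separating a connected one. This supplies \<open>unbdd\<close> for a component through
  infinity.\<close>

lemma connectedin_riemann_sphere_no_compact_part:
  assumes K: "connectedin riemann_sphere (insert None (Some ` F))"
    and T: "T \<subseteq> F" "compact T" "closed (F - T)"
  shows "T = {}"
proof (rule ccontr)
  assume "T \<noteq> {}"
  let ?K = "insert None (Some ` F)" and ?E = "insert None (Some ` (F - T))"
  have "closedin riemann_sphere (Some ` T)" "closedin riemann_sphere ?E"
    using T closedin_riemann_sphere_None by auto
  moreover have "?K \<subseteq> Some ` T \<union> ?E" "Some ` T \<inter> ?E \<inter> ?K = {}" "Some ` T \<inter> ?K \<noteq> {}" "?E \<inter> ?K \<noteq> {}"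
    using T(1) \<open>T \<noteq> {}\<close> by auto
  ultimately show False
    using K unfolding connectedin_closedin by blast
qed

text \<open>Removing infinity from \<open>K\<close> leaves a closed \<open>F\<close>, while
  \<open>K'\<close> is a compact planar set. Since \<open>K\<close> is not just infinity,
  \<open>F\<close> is nonempty and \<open>- F\<close> is a proper subset of the plane, as the
  Riemann mapping theorem requires.\<close>

lemma squeezing_bound_near_infinity:
  assumes D: "open D" "connected D" "D \<noteq> {}"
    and eq: "K \<union> K' = UNIV - Some ` D" "K \<inter> K' = {}"
    and K: "closedin riemann_sphere K" "connectedin riemann_sphere K" "None \<in> K" "K \<noteq> {None}"
    and K': "closedin riemann_sphere K'"
  obtains \<phi> R c where "\<phi> holomorphic_on D" "inj_on \<phi> D" "\<phi> ` D \<subseteq> ball 0 1" "0 < c"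
    "\<And>p. \<lbrakk>p \<in> D; R < norm p\<rbrakk> \<Longrightarrow> c \<le> squeezing_function D p"
proof -
  obtain F where F: "closed F" "K = insert None (Some ` F)"
    using K(1,3) by (cases rule: closedin_riemann_sphere_cases) auto
  obtain B where B: "compact B" "K' = Some ` B"
    using K' K(3) eq(2) by (cases rule: closedin_riemann_sphere_cases) auto
  have "x \<in> - D \<longleftrightarrow> Some x \<in> K \<union> K'" for x
    unfolding eq by auto
  then have FB: "- D = F \<union> B"
    using F B by auto
  have disj: "F \<inter> B = {}" and ne: "F \<noteq> {}"
    using eq(2) K(4) F B by auto
  show thesis
  proof (rule uniformize_unbounded_complement[OF D FB disj F(1) ne B(1)])
    show "T = {}" if "T \<subseteq> F" "compact T" "closed (F - T)" for T
      using connectedin_riemann_sphere_no_compact_part[OF _ that] K(2) F(2) by simp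
  qed (rule that)
qed

text \<open>Inversion at \<open>a\<close> moves \<open>K\<close> to a component through infinity,
  and \<open>squeezing_function_image_le\<close> carries the bound found there back to
  \<open>D\<close>.\<close>

lemma squeezing_bound_near_finite_point:
  assumes D: "open D" "connected D" "D \<noteq> {}"
    and eq: "K \<union> K' = UNIV - Some ` D" "K \<inter> K' = {}"
    and K: "closedin riemann_sphere K" "connectedin riemann_sphere K" "Some a \<in> K" "K \<noteq> {Some a}"
    and K': "closedin riemann_sphere K'"
  obtains e c where "0 < e" "0 < c"
    "\<And>p. \<lbrakk>p \<in> D; p \<in> ball a e\<rbrakk> \<Longrightarrow> c \<le> squeezing_function D p"
proof -
  let ?J = "sphere_inversion a"
  define h where "h = (\<lambda>z. inverse (z - a))"
  have aD: "a \<notin> D"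
    using eq K(3) by auto
  have h: "h holomorphic_on D" "inj_on h D"
    using aD unfolding h_def by (auto intro!: holomorphic_intros inj_onI)
  have D': "open (h ` D)" "connected (h ` D)" "h ` D \<noteq> {}"
    using open_mapping_thm3[OF h(1) D(1) h(2)] D
      connected_continuous_image[OF holomorphic_on_imp_continuous_on[OF h(1)]] by auto
  have JD: "?J ` Some ` D = Some ` h ` D"
    using aD unfolding image_image h_def by (intro image_cong refl sphere_inversion_simps(3)) auto
  have JK: "?J ` K \<union> ?J ` K' = UNIV - Some ` h ` D"
    unfolding JD[symmetric] image_Un[symmetric] eq(1)
    using surj_sphere_inversion by (simp add: image_set_diff inj_sphere_inversion)
  have disj: "?J ` K \<inter> ?J ` K' = {}"
    using eq(2) inj_sphere_inversion[of a] by (simp flip: image_Int)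
  have None: "None \<in> ?J ` K"
    using K(3) by force
  have "?J ` K \<noteq> ?J ` {Some a}"
    using K(4) inj_sphere_inversion by (metis inj_image_eq_iff)
  then have ne: "?J ` K \<noteq> {None}"
    by simp
  obtain \<phi> R c where "\<phi> holomorphic_on h ` D" "inj_on \<phi> (h ` D)" "\<phi> ` h ` D \<subseteq> ball 0 1" and c: "0 < c"
    and bound: "\<And>p. \<lbrakk>p \<in> h ` D; R < norm p\<rbrakk> \<Longrightarrow> c \<le> squeezing_function (h ` D) p"
    by (rule squeezing_bound_near_infinity[OF D' JK disj closedin_sphere_inversion_image[OF K(1)]
        connectedin_continuous_map_image[OF continuous_map_sphere_inversion K(2)] None ne
        closedin_sphere_inversion_image[OF K']]) (rule that)
  \<comment> \<open>\<open>R\<close> may be negative, so a positive radius is substituted before it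
    is inverted into \<open>e\<close>.\<close>
  obtain m where m: "0 < m" "R \<le> m"
    by (rule that[of "max 1 R"]) auto
  define e where "e = inverse m"
  show thesis
  proof (rule that[OF _ c])
    show "0 < e"
      using m by (simp add: e_def)
    fix p assume p: "p \<in> D" "p \<in> ball a e"
    have "p \<noteq> a"
      using p aD by auto
    have "norm (p - a) < inverse m"
      using p by (simp add: e_def dist_norm norm_minus_commute)
    then have "m < inverse (norm (p - a))"
      using \<open>p \<noteq> a\<close> m by (simp add: field_simps)
    then have "R < norm (h p)"
      using m by (simp add: h_def norm_inverse)
    then have "c \<le> squeezing_function (h ` D) (h p)"
      using p by (intro bound) auto
    also have "\<dots> \<le> squeezing_function D p"
      using D p h by (intro squeezing_function_image_le)
    finally show "c \<le> squeezing_function D p" .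
  qed
qed

text \<open>Any embedding \<open>\<phi>\<close> into the disc, translated so that \<open>p\<close>
  goes to 0 and halved to stay in the disc, is a competing map.\<close>

lemma squeezing_bound_near_interior_point:
  assumes D: "open D" "q \<in> D"
    and \<phi>: "\<phi> holomorphic_on D" "inj_on \<phi> D" "\<phi> ` D \<subseteq> ball 0 1"
  obtains U c where "open U" "q \<in> U" "0 < c" "\<And>p. p \<in> U \<Longrightarrow> p \<in> D \<Longrightarrow> c \<le> squeezing_function D p"
proof -
  have "open (\<phi> ` D)"
    by (rule open_mapping_thm3[OF \<phi>(1) D(1) \<phi>(2)])
  \<comment> \<open>With radius \<open>2 * e\<close> around \<open>\<phi> q\<close>, every
    \<open>\<phi> p\<close> within \<open>e\<close> still has a disc of radius \<open>e\<close> in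
    the image; halving makes it \<open>e / 2\<close>.\<close>
  then obtain e where e: "e > 0" "ball (\<phi> q) (2 * e) \<subseteq> \<phi> ` D"
    using D(2) open_contains_ball_eq[of "\<phi> ` D"] by (metis field_sum_of_halves half_gt_zero imageI mult_2)
  define U where "U = \<phi> -` ball (\<phi> q) e \<inter> D"
  have "open U"
    unfolding U_def using D holomorphic_on_imp_continuous_on[OF \<phi>(1)]
    by (simp add: continuous_on_open_vimage)
  moreover have "q \<in> U"
    using D e by (simp add: U_def)
  moreover have "e / 2 \<le> squeezing_function D p" if p: "p \<in> U" for p
  proof (rule squeezing_function_ge[of _ _ "\<lambda>z. (\<phi> z - \<phi> p) / 2"])
    show "p \<in> D"
      using p by (simp add: U_def)
    have "norm ((\<phi> z - \<phi> p) / 2) < 1" if "z \<in> D" for z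
    proof -
      have "norm (\<phi> z) < 1" "norm (\<phi> p) < 1"
        using \<phi>(3) that \<open>p \<in> D\<close> by (auto simp: image_subset_iff)
      then show ?thesis
        using norm_triangle_ineq4[of "\<phi> z" "\<phi> p"] by (simp add: norm_divide)
    qed
    then show "(\<lambda>z. (\<phi> z - \<phi> p) / 2) \<in> squeezing_maps D p"
      using \<phi> unfolding squeezing_maps_def
      by (auto intro!: holomorphic_intros simp: inj_on_def)
    show "ball 0 (e / 2) \<subseteq> (\<lambda>z. (\<phi> z - \<phi> p) / 2) ` D"
    proof
      fix y :: complex assume y: "y \<in> ball 0 (e / 2)"
      have "dist (\<phi> q) (\<phi> p + 2 * y) \<le> dist (\<phi> q) (\<phi> p) + norm (2 * y)"
        by (metis add.commute add_diff_cancel_left' dist_commute dist_norm dist_triangle)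
      also have "\<dots> < 2 * e"
        using y p by (simp add: U_def norm_mult)
      finally obtain z where "z \<in> D" "\<phi> z = \<phi> p + 2 * y"
        using e by (metis imageE mem_ball subsetD)
      then show "y \<in> (\<lambda>z. (\<phi> z - \<phi> p) / 2) ` D"
        by (intro image_eqI[of _ _ z]) auto
    qed
  qed (use D e in auto)
  ultimately show thesis
    using e by (intro that[of U "e / 2"]) auto
qed

subsection \<open>The characterization\<close>

text \<open>Components of the closed complement are closed. As there are finitely many, the union of
  the others is closed too, which isolates \<open>K\<close> from the rest.\<close>

lemma complement_component:
  assumes "open D" "finite (complement_components D)" "K \<in> complement_components D"
  shows "K \<subseteq> UNIV - Some ` D" "closedin riemann_sphere K" "connectedin riemann_sphere K"
    "closedin riemann_sphere (UNIV - Some ` D - K)"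
proof -
  let ?S = "UNIV - Some ` D"
  let ?X = "subtopology riemann_sphere ?S"
  have C: "complement_components D = connected_components_of ?X"
    by (simp add: complement_components_def)
  have S: "closedin riemann_sphere ?S"
    using assms(1) closedin_topspace[of riemann_sphere] by (intro closedin_diff) simp_all
  have closed: "closedin riemann_sphere L" if "L \<in> complement_components D" for L
    using closedin_connected_components_of[of L ?X] that S
    by (simp add: C closedin_closed_subtopology)
  show "K \<subseteq> ?S"
    using connected_components_of_subset[of K ?X] assms(3) by (simp add: C)
  show "closedin riemann_sphere K"
    using closed assms(3) .
  show "connectedin riemann_sphere K"
    using connectedin_connected_components_of[of K ?X] assms(3) by (simp add: C connectedin_subtopology)
  have "?S - K = \<Union> (complement_components D - {K})"
    using complement_connected_components_of_Union[of K ?X] assms(3) by (simp add: C)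
  moreover have "closedin riemann_sphere (\<Union> (complement_components D - {K}))"
    using assms(2) closed by (intro closedin_Union) auto
  ultimately show "closedin riemann_sphere (?S - K)"
    by simp
qed

lemma in_complement_component:
  assumes "x \<notin> Some ` D"
  obtains K where "K \<in> complement_components D" "x \<in> K"
proof -
  have "x \<in> \<Union> (complement_components D)"
    using assms by (simp add: complement_components_def Union_connected_components_of)
  then show thesis
    using that by blast
qed

text \<open>Assumption \<open>closed\<close> makes \<open>x\<close> isolated in the complement. Its
  punctured neighbourhood has the chart R/w at infinity and a + e w at a finite point.\<close>

lemma squeezing_function_small_near_puncture:
  assumes D: "open D" and x: "x \<notin> Some ` D"
    and closed: "closedin riemann_sphere (UNIV - Some ` D - {x})" and "0 < c"
  shows "\<exists>p\<in>D. squeezing_function D p < c"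
proof -
  have "\<exists>\<phi> :: complex \<Rightarrow> complex. \<forall>w. 0 < norm w \<and> norm w < 1 \<longrightarrow> \<phi> w \<in> D \<and> squeezing_function D (\<phi> w) \<le> norm w"
  proof (cases x)
    case None
    obtain B where B: "compact B" "UNIV - Some ` D - {x} = Some ` B"
      using closed None by (cases rule: closedin_riemann_sphere_cases) auto
    have "z \<in> - D \<longleftrightarrow> Some z \<in> UNIV - Some ` D - {x}" for z
      using None by auto
    then have DB: "- D = B"
      using B(2) by auto
    obtain R where R: "R > 0" "\<And>z. z \<in> B \<Longrightarrow> norm z \<le> R"
      using compact_imp_bounded[OF B(1)] bounded_pos by metis
    define \<phi> :: "complex \<Rightarrow> complex" where "\<phi> = (\<lambda>w. of_real R / w)"
    have norm_\<phi>: "norm (\<phi> w) = R / norm w" for w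
      using R by (simp add: \<phi>_def norm_divide)
    have hol: "\<phi> holomorphic_on ball 0 1 - {0}"
      unfolding \<phi>_def by (intro holomorphic_intros) auto
    have inj: "inj_on \<phi> (ball 0 1 - {0})"
      using R by (auto simp: \<phi>_def inj_on_def)
    have sub: "\<phi> ` (ball 0 1 - {0}) \<subseteq> D"
    proof (rule image_subsetI)
      fix w :: complex assume "w \<in> ball 0 1 - {0}"
      then have "R < norm (\<phi> w)"
        using R by (simp add: norm_\<phi> field_simps)
      then show "\<phi> w \<in> D"
        using R(2)[of "\<phi> w"] DB by force
    qed
    have escape: "\<exists>N \<delta>. open N \<and> q \<in> N \<and> 0 < \<delta> \<and> (\<forall>w. 0 < norm w \<and> norm w < \<delta> \<longrightarrow> \<phi> w \<notin> N)"
      if "q \<in> D" for q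
    proof (intro exI conjI allI impI)
      \<comment> \<open>Below this threshold \<open>norm (\<phi> w)\<close> exceeds
        \<open>norm q + 1\<close>, so \<open>\<phi> w\<close> leaves the ball of that radius around
        0.\<close>
      let ?\<delta> = "R / (norm q + 1)"
      have pos: "0 < norm q + 1"
        by (rule add_nonneg_pos) simp_all
      then show "open (ball 0 (norm q + 1))" "q \<in> ball 0 (norm q + 1)" "0 < ?\<delta>"
        using R(1) by simp_all
      fix w :: complex assume w: "0 < norm w \<and> norm w < ?\<delta>"
      then have "norm w * (norm q + 1) < R"
        by (simp only: pos_less_divide_eq[OF pos])
      then have "norm q + 1 < norm (\<phi> w)"
        unfolding norm_\<phi> using w by (subst pos_less_divide_eq) (auto simp: mult.commute)
      then show "\<phi> w \<notin> ball 0 (norm q + 1)"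
        by simp
    qed
    have "squeezing_function D (\<phi> w) \<le> norm w" if "0 < norm w" "norm w < 1" for w
      using D hol inj sub escape that by (rule squeezing_function_le_isolated)
    then show ?thesis
      using sub by (intro exI[of _ \<phi>]) auto
  next
    case (Some a)
    obtain F where F: "closed F" "\<And>z. Some z \<in> UNIV - Some ` D - {x} \<longleftrightarrow> z \<in> F"
      using closed
    proof (cases rule: closedin_riemann_sphere_cases)
      case (1 B)
      show thesis
      proof (rule that)
        show "closed B"
          using 1(1) by (rule compact_imp_closed)
        show "Some z \<in> UNIV - Some ` D - {x} \<longleftrightarrow> z \<in> B" for z
          unfolding 1(2) by auto
      qed
    next
      case (2 F)
      show thesis
      proof (rule that)
        show "Some z \<in> UNIV - Some ` D - {x} \<longleftrightarrow> z \<in> F" for z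
          unfolding 2(2) by auto
      qed (rule 2(1))
    qed
    have DF: "z \<in> D" if "z \<in> - F" "z \<noteq> a" for z
      using F(2)[of z] that Some by auto
    have "a \<in> - F"
      using F(2)[of a] Some by auto
    then obtain e where e: "e > 0" "ball a e \<subseteq> - F"
      using F(1) open_contains_ball by (metis open_Compl)
    define \<phi> where "\<phi> = (\<lambda>w. a + of_real e * w)"
    have dist_\<phi>: "dist a (\<phi> w) = e * norm w" for w
      using e by (simp add: \<phi>_def dist_norm norm_mult)
    have hol: "\<phi> holomorphic_on ball 0 1 - {0}"
      unfolding \<phi>_def by (intro holomorphic_intros)
    have inj: "inj_on \<phi> (ball 0 1 - {0})"
      using e by (auto simp: \<phi>_def inj_on_def)
    have sub: "\<phi> ` (ball 0 1 - {0}) \<subseteq> D"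
    proof (intro image_subsetI DF)
      fix w :: complex assume w: "w \<in> ball 0 1 - {0}"
      then have "\<phi> w \<in> ball a e"
        using e by (simp add: dist_\<phi>)
      then show "\<phi> w \<in> - F"
        using e by blast
      show "\<phi> w \<noteq> a"
        using w e by (simp add: \<phi>_def)
    qed
    have escape: "\<exists>N \<delta>. open N \<and> q \<in> N \<and> 0 < \<delta> \<and> (\<forall>w. 0 < norm w \<and> norm w < \<delta> \<longrightarrow> \<phi> w \<notin> N)"
      if "q \<in> D" for q
    proof (intro exI conjI allI impI)
      \<comment> \<open>If \<open>\<phi> w\<close> is closer to \<open>a\<close> than half of
        \<open>dist a q\<close>, it is farther than that from \<open>q\<close>; the threshold is
        this half divided by the scale \<open>e\<close>.\<close>
      have "q \<noteq> a"
        using that x Some by auto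
      then show "open (ball q (dist a q / 2))" "q \<in> ball q (dist a q / 2)" "0 < dist a q / (2 * e)"
        using e by auto
      fix w :: complex assume "0 < norm w \<and> norm w < dist a q / (2 * e)"
      then have "e * norm w < e * (dist a q / (2 * e))"
        using e by (intro mult_strict_left_mono) simp_all
      also have "\<dots> = dist a q / 2"
        using e by simp
      finally have "dist a (\<phi> w) < dist a q / 2"
        by (simp only: dist_\<phi>)
      moreover have "dist a q \<le> dist a (\<phi> w) + dist q (\<phi> w)"
        using dist_triangle[of a q "\<phi> w"] by (simp only: dist_commute)
      ultimately show "\<phi> w \<notin> ball q (dist a q / 2)"
        by simp
    qed
    have "squeezing_function D (\<phi> w) \<le> norm w" if "0 < norm w" "norm w < 1" for w
      using D hol inj sub escape that by (rule squeezing_function_le_isolated)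
    then show ?thesis
      using sub by (intro exI[of _ \<phi>]) auto
  qed
  then obtain \<phi> :: "complex \<Rightarrow> complex" where \<phi>: "\<And>w. 0 < norm w \<Longrightarrow> norm w < 1 \<Longrightarrow> \<phi> w \<in> D"
      "\<And>w. 0 < norm w \<Longrightarrow> norm w < 1 \<Longrightarrow> squeezing_function D (\<phi> w) \<le> norm w"
    by metis
  \<comment> \<open>The entry \<open>1 / 2\<close> keeps \<open>w\<close> in the unit disc, and
    \<open>c / 2\<close> makes the bound \<open>norm w\<close> smaller than
    \<open>c\<close>.\<close>
  define w :: complex where "w = of_real (min (1 / 2) (c / 2))"
  have w: "0 < norm w" "norm w < 1" "norm w < c"
    using \<open>0 < c\<close> by (auto simp: w_def)
  then show ?thesis
    using \<phi>[of w] by (intro bexI[of _ "\<phi> w"]) linarith+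
qed

theorem mainTheorem13:
  fixes D :: "complex set"
  assumes "planar_domain D"
    and "finitely_connected D"
  shows "holomorphic_homogeneous_regular D \<longleftrightarrow>
    (\<forall>K\<in>complement_components D. \<not> is_singleton K)"
proof -
  have D: "open D" "connected D" "D \<noteq> {}" and fin: "finite (complement_components D)"
    using assms by (auto simp: planar_domain_def finitely_connected_def)
  note comp = complement_component[OF D(1) fin]
  show ?thesis
  proof (intro iffI ballI notI)
    fix K assume "holomorphic_homogeneous_regular D" and K: "K \<in> complement_components D" "is_singleton K"
    then obtain c where c: "c > 0" "\<And>p. p \<in> D \<Longrightarrow> c \<le> squeezing_function D p"
      unfolding holomorphic_homogeneous_regular_def by blast
    obtain x where x: "K = {x}"
      using K(2) by (rule is_singletonE)
    have "\<exists>p\<in>D. squeezing_function D p < c"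
      using comp(1,4)[OF K(1)] x c(1) by (intro squeezing_function_small_near_puncture[OF D(1), of x]) auto
    then show False
      using c(2) by force
  next
    assume nonsing: "\<forall>K\<in>complement_components D. \<not> is_singleton K"
    have component: "\<exists>K. x \<in> K \<and> K \<noteq> {x} \<and> closedin riemann_sphere K \<and> connectedin riemann_sphere K \<and>
        K \<union> (UNIV - Some ` D - K) = UNIV - Some ` D \<and> closedin riemann_sphere (UNIV - Some ` D - K)"
      if x: "x \<notin> Some ` D" for x
    proof -
      obtain K where K: "K \<in> complement_components D" "x \<in> K"
        using x by (rule in_complement_component)
      have "K \<noteq> {x}"
        using nonsing K(1) is_singletonI by blast
      then show ?thesis
        using comp[OF K(1)] K(2) by (intro exI[of _ K]) auto
    qed
    \<comment> \<open>The component through infinity provides both the embedding onto a bounded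
      domain and the bound for large \<open>p\<close>.\<close>
    obtain K where K: "None \<in> K" "K \<noteq> {None}" "closedin riemann_sphere K" "connectedin riemann_sphere K"
        "K \<union> (UNIV - Some ` D - K) = UNIV - Some ` D" "closedin riemann_sphere (UNIV - Some ` D - K)"
      using component[of None] by auto
    have "K \<inter> (UNIV - Some ` D - K) = {}"
      by blast
    from squeezing_bound_near_infinity[OF D K(5) this K(3,4,1,2,6)]
    obtain \<phi> R c\<^sub>0 where \<phi>: "\<phi> holomorphic_on D" "inj_on \<phi> D" "\<phi> ` D \<subseteq> ball 0 1" and "0 < c\<^sub>0"
      and infinity: "\<And>p. \<lbrakk>p \<in> D; R < norm p\<rbrakk> \<Longrightarrow> c\<^sub>0 \<le> squeezing_function D p"
      by metis
    have "planar_domain (\<phi> ` D)" "bounded (\<phi> ` D)"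
      using open_mapping_thm3[OF \<phi>(1) D(1) \<phi>(2)] D \<phi>(3) bounded_ball bounded_subset
        connected_continuous_image[OF holomorphic_on_imp_continuous_on[OF \<phi>(1)] D(2)]
      by (auto simp: planar_domain_def)
    then have bih: "\<exists>E. planar_domain E \<and> bounded E \<and> biholomorphic D E"
      using biholomorphic_image[OF D(1) \<phi>(1,2)] by blast
    \<comment> \<open>Local bounds are found at every point of the sphere, in \<open>D\<close> or
      not, so that compactness of the whole sphere applies.\<close>
    have "\<exists>U c. openin riemann_sphere U \<and> x \<in> U \<and> 0 < c \<and>
        (\<forall>p\<in>D. Some p \<in> U \<longrightarrow> c \<le> squeezing_function D p)" for x
    proof (cases x)
      case None
      have "openin riemann_sphere (insert None (Some ` (- cball 0 R)))"
        by (rule openin_riemann_sphere_None) simp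
      then show ?thesis
        using None \<open>0 < c\<^sub>0\<close> infinity
        by (intro exI[of _ "insert None (Some ` (- cball 0 R))"] exI[of _ c\<^sub>0]) auto
    next
      case (Some a)
      have "\<exists>U c. open U \<and> a \<in> U \<and> 0 < c \<and> (\<forall>p\<in>D. p \<in> U \<longrightarrow> c \<le> squeezing_function D p)"
      proof (cases "a \<in> D")
        case True
        obtain U c where "open U" "a \<in> U" "0 < c"
          "\<And>p. p \<in> U \<Longrightarrow> p \<in> D \<Longrightarrow> c \<le> squeezing_function D p"
          by (rule squeezing_bound_near_interior_point[OF D(1) True \<phi>]) (rule that)
        then show ?thesis
          by blast
      next
        case False
        then obtain L where L: "Some a \<in> L" "L \<noteq> {Some a}" "closedin riemann_sphere L" "connectedin riemann_sphere L"
            "L \<union> (UNIV - Some ` D - L) = UNIV - Some ` D" "closedin riemann_sphere (UNIV - Some ` D - L)"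
          using component[of "Some a"] by auto
        have disj: "L \<inter> (UNIV - Some ` D - L) = {}"
          by blast
        obtain e c where "0 < e" "0 < c"
          "\<And>p. \<lbrakk>p \<in> D; p \<in> ball a e\<rbrakk> \<Longrightarrow> c \<le> squeezing_function D p"
          by (rule squeezing_bound_near_finite_point[OF D L(5) disj L(3,4,1,2,6)]) (rule that)
        then show ?thesis
          by (intro exI[of _ "ball a e"] exI[of _ c]) auto
      qed
      then obtain U c where "open U" "a \<in> U" "0 < c" "\<forall>p\<in>D. p \<in> U \<longrightarrow> c \<le> squeezing_function D p"
        by blast
      then show ?thesis
        using Some by (intro exI[of _ "Some ` U"] exI[of _ c]) auto
    qed
    then obtain U c where U: "\<And>x. openin riemann_sphere (U x)" "\<And>x. x \<in> U x"
      and c: "\<And>x. (0::real) < c x" "\<And>x p. p \<in> D \<Longrightarrow> Some p \<in> U x \<Longrightarrow> c x \<le> squeezing_function D p"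
      by metis
    have "compactin riemann_sphere UNIV"
      using compact_space_riemann_sphere by (simp add: compact_space_def)
    then obtain \<F> where "finite \<F>" "\<F> \<subseteq> range U" "UNIV \<subseteq> \<Union> \<F>"
      using compactinD[of riemann_sphere UNIV "range U"] U by blast
    then obtain I where I: "finite I" "UNIV \<subseteq> \<Union> (U ` I)"
      using finite_subset_image by metis
    have "I \<noteq> {}"
      using I(2) by auto
    \<comment> \<open>The least constant of a finite subcover bounds the squeezing function on all
      of \<open>D\<close>.\<close>
    have "0 < Min (c ` I)"
      using I(1) \<open>I \<noteq> {}\<close> c(1) by simp
    moreover have "Min (c ` I) \<le> squeezing_function D p" if "p \<in> D" for p
    proof -
      obtain x where x: "x \<in> I" "Some p \<in> U x"
        using I(2) by blast
      have "Min (c ` I) \<le> c x"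
        using I(1) x(1) by simp
      also have "\<dots> \<le> squeezing_function D p"
        using that x(2) by (rule c(2))
      finally show ?thesis .
    qed
    ultimately show "holomorphic_homogeneous_regular D"
      unfolding holomorphic_homogeneous_regular_def using assms(1) bih by blast
  qed
qed

end
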